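(* Let $c>0$ be a constant and for every $n\geq0$ let $S_n=\left[-\lceil cn^{3/2}\rceil,\lceil cn^{3/2}\rceil\right]^2$ (grid graph), $\underline{S}=(S_n)_{n\ge0}$. Then there is a sequence of activated vertices $\underline{v}$ with lower burning density $\underline{\delta}(\underline{S},\underline{v})>0$.
   Context: For integers $a\le b$, $[a,b]^2$ denotes the graph on vertex set $[a,b]^2\subset\mathbb{Z}^2$ in which two vertices are adjacent iff their $L_1$-distance is $1$. Burning process: let $\underline{G}=(G_0,G_1,\dots)$ be graphs with $G_{n-1}$ an induced subgraph of $G_n$ for all $n\ge1$. A sequence of activated vertices is $\underline{v}=(v_n)_{n\ge0}$ with $v_n\in V(G_n)\cup\{\bullet\}$ ($\bullet$ means no vertex is activated). Burning sets: $B_0=\{v_0\}$ (empty if $v_0=\bullet$), and $B_{n+1}=N_{G_{n+1}}[B_n]$ if $v_{n+1}=\bullet$, and $B_{n+1}=N_{G_{n+1}}[B_n]\cup\{v_{n+1}\}$ otherwise, where $N_G[X]$ is the closed neighbourhood of $X$ in $G$. The lower burning density is $\underline{\delta}(\underline{G},\underline{v})=\liminf_{n\to\infty}|B_n|/|V(G_n)|$. *)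

theory Defs
  imports
    "HOL-Library.Extended_Real"
    "Graph_Theory.Pair_Digraph"
    "Graph_Theory.Digraph_Component"
begin

text \<open>
  Finite simple graphs are symmetric loop-free finite digraphs whose arcs are pairs of vertices
  (locale \<^locale>\<open>pair_graph\<close>).
\<close>

definition l1_dist :: "int \<times> int \<Rightarrow> int \<times> int \<Rightarrow> int" where
  "l1_dist u v = \<bar>fst u - fst v\<bar> + \<bar>snd u - snd v\<bar>"

definition grid_graph :: "int \<Rightarrow> int \<Rightarrow> (int \<times> int) pair_pre_digraph" where
  "grid_graph a b =
    \<lparr> pverts = {a..b} \<times> {a..b},
      parcs = {(u, v). u \<in> {a..b} \<times> {a..b} \<and> v \<in> {a..b} \<times> {a..b} \<and> l1_dist u v = 1} \<rparr>"

definition growing_graphs :: "(nat \<Rightarrow> 'a pair_pre_digraph) \<Rightarrow> bool" where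
  "growing_graphs G \<longleftrightarrow>
    (\<forall>n. pair_graph (G n)) \<and>
    (\<forall>n\<ge>1. induced_subgraph (with_proj (G (n - 1))) (with_proj (G n)))"

definition closed_neighbourhood :: "'a pair_pre_digraph \<Rightarrow> 'a set \<Rightarrow> 'a set" where
  "closed_neighbourhood G X = X \<union> {w. \<exists>x\<in>X. (x, w) \<in> parcs G}"

text \<open>\<^term>\<open>None\<close> stands for ``no vertex is activated''.\<close>

definition activation_sequence ::
    "(nat \<Rightarrow> 'a pair_pre_digraph) \<Rightarrow> (nat \<Rightarrow> 'a option) \<Rightarrow> bool" where
  "activation_sequence G v \<longleftrightarrow> (\<forall>n. v n \<in> insert None (Some ` pverts (G n)))"

primrec burning_set ::
    "(nat \<Rightarrow> 'a pair_pre_digraph) \<Rightarrow> (nat \<Rightarrow> 'a option) \<Rightarrow> nat \<Rightarrow> 'a set" where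
  "burning_set G v 0 = (case v 0 of None \<Rightarrow> {} | Some x \<Rightarrow> {x})"
| "burning_set G v (Suc n) =
    (case v (Suc n) of
       None \<Rightarrow> closed_neighbourhood (G (Suc n)) (burning_set G v n)
     | Some x \<Rightarrow> closed_neighbourhood (G (Suc n)) (burning_set G v n) \<union> {x})"

text \<open>
  The limit inferior is taken in \<^typ>\<open>ereal\<close>, where it always exists.
\<close>

definition lower_burning_density ::
    "(nat \<Rightarrow> 'a pair_pre_digraph) \<Rightarrow> (nat \<Rightarrow> 'a option) \<Rightarrow> ereal" where
  "lower_burning_density G v =
    liminf (\<lambda>n. ereal (real (card (burning_set G v n)) / real (card (pverts (G n)))))"

lemma pair_graph_grid_graph: "pair_graph (grid_graph a b)"
proof
  show "finite (parcs (grid_graph a b))"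
    by (rule finite_subset[of _ "({a..b} \<times> {a..b}) \<times> ({a..b} \<times> {a..b})"])
       (auto simp: grid_graph_def)
  show "symmetric (with_proj (grid_graph a b))"
    by (auto simp: symmetric_def sym_def arcs_ends_conv grid_graph_def l1_dist_def abs_minus_commute)
qed (auto simp: grid_graph_def l1_dist_def)

lemma induced_subgraph_grid_graph:
  assumes "a' \<le> a" "b \<le> b'"
  shows "induced_subgraph (with_proj (grid_graph a b)) (with_proj (grid_graph a' b'))"
proof -
  have "wf_digraph (with_proj (grid_graph x y))" for x y
    by unfold_locales (auto simp: grid_graph_def)
  then show ?thesis
    using assms
    by (auto simp: induced_subgraph_def subgraph_def compatible_def grid_graph_def)
qed

lemma growing_graphs_grid_graph:
  fixes r :: "nat \<Rightarrow> int"
  assumes "mono r"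
  shows "growing_graphs (\<lambda>n. grid_graph (- r n) (r n))"
  unfolding growing_graphs_def
  using monoD[OF assms, of "_ - 1" "_"]
  by (auto intro!: pair_graph_grid_graph induced_subgraph_grid_graph)

lemma growing_graphs_squares:
  fixes c :: real
  assumes "c > 0"
  shows "growing_graphs (\<lambda>n. grid_graph (- \<lceil>c * real n powr (3/2)\<rceil>) \<lceil>c * real n powr (3/2)\<rceil>)"
  using assms
  by (intro growing_graphs_grid_graph monoI ceiling_mono mult_left_mono powr_mono2) auto

lemma burning_set_subset_pverts:
  assumes "growing_graphs G" "activation_sequence G v"
  shows "burning_set G v n \<subseteq> pverts (G n)"
proof -
  have act: "x \<in> pverts (G m)" if "v m = Some x" for m x
    using assms(2) spec[of "\<lambda>n. v n \<in> insert None (Some ` pverts (G n))" m] that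
    by (auto simp: activation_sequence_def)
  show ?thesis
  proof (induction n)
    case 0
    then show ?case
      by (auto intro: act split: option.splits)
  next
    case (Suc n)
    have "induced_subgraph (with_proj (G (Suc n - 1))) (with_proj (G (Suc n)))"
      using assms(1) unfolding growing_graphs_def by (metis One_nat_def le_add1 plus_1_eq_Suc)
    then have "pverts (G n) \<subseteq> pverts (G (Suc n))"
      by (auto simp: induced_subgraph_def subgraph_def)
    moreover interpret pair_graph "G (Suc n)"
      using assms(1) by (simp add: growing_graphs_def)
    have "closed_neighbourhood (G (Suc n)) X \<subseteq> pverts (G (Suc n))"
      if "X \<subseteq> pverts (G (Suc n))" for X
      using that by (auto simp: closed_neighbourhood_def dest: in_arcsD2)
    ultimately have "closed_neighbourhood (G (Suc n)) (burning_set G v n) \<subseteq> pverts (G (Suc n))"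
      using Suc.IH by simp
    then show ?case
      by (auto intro: act split: option.splits)
  qed
qed

end

theory Submission
  imports Defs "HOL-Library.Log_Nat"
begin

text \<open>
  In the time window \<open>[4^k, 2 \<sqdot> 4^k)\<close> activate the \<open>2^k \<times> 2^k\<close> points of a square lattice
  of spacing \<open>d\<close>, where \<open>d\<close> is about \<open>min c (1/2) \<sqdot> 4^k\<close>. Every cell of this lattice has
  \<open>L\<^sub>1\<close>-diameter less than \<open>2 d \<le> 4^k\<close>, so at time \<open>3 \<sqdot> 4^k\<close> the whole square
  \<open>[0, 2^k d)\<^sup>2\<close> burns. Its area is of order \<open>64^k\<close>, which is also the order of the number of
  vertices of the graph up to time \<open>4^(k+2)\<close>, when the square of the next window is burning.
\<close>

section \<open>Propagation of fire inside a fixed box\<close>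

lemma burning_set_step:
  "closed_neighbourhood (G (Suc n)) (burning_set G v n) \<subseteq> burning_set G v (Suc n)"
  by (auto split: option.splits)

lemma burning_set_mono:
  assumes "m \<le> n"
  shows "burning_set G v m \<subseteq> burning_set G v n"
  using assms
proof (induction n rule: dec_induct)
  case (step n)
  then show ?case
    using burning_set_step[of G n v] by (auto simp: closed_neighbourhood_def)
qed simp

lemma activated_in_burning_set: "v n = Some x \<Longrightarrow> x \<in> burning_set G v n"
  by (cases n) auto

text \<open>Moving \<open>q\<close> one unit towards \<open>p\<close> in a coordinate where they
  differ stays between the two, hence inside the box.\<close>

lemma grid_step_closer:
  assumes "p \<in> {a..b} \<times> {a..b}" "q \<in> {a..b} \<times> {a..b}" "p \<noteq> q"
  obtains q' where "q' \<in> {a..b} \<times> {a..b}" "l1_dist q' q = 1" "l1_dist p q = l1_dist p q' + 1"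
proof -
  obtain x y z w where eq: "p = (x, y)" "q = (z, w)"
    by (cases p, cases q)
  consider "z < x" | "x < z" | "x = z" "w < y" | "x = z" "y < w"
    using assms(3) eq by fastforce
  then show thesis
  proof cases
    case 1
    then show ?thesis using assms eq by (intro that[of "(z + 1, w)"]) (auto simp: l1_dist_def)
  next
    case 2
    then show ?thesis using assms eq by (intro that[of "(z - 1, w)"]) (auto simp: l1_dist_def)
  next
    case 3
    then show ?thesis using assms eq by (intro that[of "(z, w + 1)"]) (auto simp: l1_dist_def)
  next
    case 4
    then show ?thesis using assms eq by (intro that[of "(z, w - 1)"]) (auto simp: l1_dist_def)
  qed
qed

text \<open>Fire follows a shortest path from \<open>p\<close> to \<open>q\<close> inside the box
  \<open>[a, b]\<close>, one edge per time step. As every graph from time \<open>m\<close> on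
  contains this box, its growth cannot interfere.\<close>

lemma burning_set_spreads:
  assumes sub: "\<And>n. n \<ge> m \<Longrightarrow> a' n \<le> a \<and> b \<le> b' n"
    and p: "p \<in> burning_set (\<lambda>n. grid_graph (a' n) (b' n)) v m" "p \<in> {a..b} \<times> {a..b}"
    and q: "q \<in> {a..b} \<times> {a..b}" "l1_dist p q \<le> int t"
  shows "q \<in> burning_set (\<lambda>n. grid_graph (a' n) (b' n)) v (m + t)"
  using q
proof (induction t arbitrary: q)
  case 0
  then have "p = q"
    by (auto simp: l1_dist_def prod_eq_iff)
  then show ?case
    using p by simp
next
  case (Suc t)
  let ?G = "\<lambda>n. grid_graph (a' n) (b' n)"
  have step: "closed_neighbourhood (?G (Suc (m + t))) (burning_set ?G v (m + t))
      \<subseteq> burning_set ?G v (m + Suc t)"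
    using burning_set_step[of ?G "m + t" v] by simp
  show ?case
  proof (cases "p = q")
    case True
    then show ?thesis
      using p(1) burning_set_mono[of m "m + Suc t" ?G v] by auto
  next
    case False
    obtain q' where q': "q' \<in> {a..b} \<times> {a..b}" "l1_dist q' q = 1"
      "l1_dist p q = l1_dist p q' + 1"
      using grid_step_closer[OF p(2) Suc.prems(1) False] by blast
    have "q' \<in> burning_set ?G v (m + t)"
      using q' Suc.prems by (intro Suc.IH) auto
    moreover have "(q', q) \<in> parcs (?G (Suc (m + t)))"
      using q' Suc.prems sub[of "Suc (m + t)"] by (auto simp: grid_graph_def)
    ultimately show ?thesis
      using step by (auto simp: closed_neighbourhood_def)
  qed
qed

section \<open>The activation schedule and the squares it burns\<close>

text \<open>For \<open>m > 0\<close>, \<open>k\<close> is the integer part of the base-4 logarithm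
  of \<open>m\<close>; the offset in the window is read as two digits in base \<open>2 ^ k\<close>,
  the lattice coordinates. At \<open>m = 0\<close> the value is \<open>k = 0\<close>, and the test
  \<open>4 ^ k \<le> m\<close> rejects it.\<close>

definition lattice_activation :: "(nat \<Rightarrow> int) \<Rightarrow> nat \<Rightarrow> (int \<times> int) option" where
  "lattice_activation d m =
    (let k = floorlog 4 m - 1; j = m - 4 ^ k in
      if 4 ^ k \<le> m \<and> j < 4 ^ k
      then Some (int (j div 2 ^ k) * d k, int (j mod 2 ^ k) * d k) else None)"

lemma four_power_eq: "(4::nat) ^ k = 2 ^ k * 2 ^ k"
  by (simp flip: power_mult_distrib)

lemma lattice_activation_eq:
  assumes "i < 2 ^ k" "j < 2 ^ k"
  shows "lattice_activation d (4 ^ k + (i * 2 ^ k + j)) = Some (int i * d k, int j * d k)"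
proof -
  \<comment> \<open>The offset stays below \<open>4 ^ k\<close>, so the time is below
    \<open>4 ^ (k + 1)\<close> and \<open>floorlog\<close> recovers \<open>k\<close>.\<close>
  have "(i + 1) * 2 ^ k \<le> 2 ^ k * (2 ^ k :: nat)"
    using assms by (intro mult_right_mono) auto
  then have lt: "i * 2 ^ k + j < 4 ^ k"
    using assms(2) by (simp add: four_power_eq)
  have "floorlog 4 (4 ^ k + (i * 2 ^ k + j)) = Suc k"
    using lt by (intro antisym floorlog_leI floorlog_ge_SucI) auto
  then show ?thesis
    using lt assms by (simp add: lattice_activation_def Let_def)
qed

lemma lattice_activation_SomeE:
  assumes "lattice_activation d m = Some p"
  obtains k i j where "4 ^ k \<le> m" "i < 2 ^ k" "j < 2 ^ k" "p = (int i * d k, int j * d k)"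
proof -
  define k where "k = floorlog 4 m - 1"
  define j where "j = m - 4 ^ k"
  have *: "4 ^ k \<le> m" "j < 2 ^ k * 2 ^ k" "p = (int (j div 2 ^ k) * d k, int (j mod 2 ^ k) * d k)"
    using assms
    by (auto simp: lattice_activation_def Let_def k_def j_def four_power_eq split: if_splits)
  show thesis
    using * by (intro that[of k "j div 2 ^ k" "j mod 2 ^ k"]) (auto simp: less_mult_imp_div_less)
qed

lemma lattice_point_le:
  assumes "i < 2 ^ k" "0 \<le> d"
  shows "int i * d + d \<le> 2 ^ k * d"
proof -
  have "int (i + 1) \<le> int (2 ^ k)"
    using assms(1) by (simp only: of_nat_le_iff)
  then have "(int i + 1) * d \<le> 2 ^ k * d"
    using assms(2) by (intro mult_right_mono) auto
  then show ?thesis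
    by (simp add: algebra_simps)
qed

lemma square_burns:
  fixes r d :: "nat \<Rightarrow> int"
  assumes r: "\<And>m. 4 ^ k \<le> m \<Longrightarrow> 2 ^ k * d k \<le> r m"
    and d: "0 \<le> d k" "2 * d k \<le> 4 ^ k"
    and n: "4 ^ (k + 1) \<le> n"
  shows "{0..<2 ^ k * d k} \<times> {0..<2 ^ k * d k}
    \<subseteq> burning_set (\<lambda>n. grid_graph (- r n) (r n)) (lattice_activation d) n"
proof
  let ?L = "2 ^ k * d k"
  let ?B = "burning_set (\<lambda>n. grid_graph (- r n) (r n)) (lattice_activation d)"
  fix q assume "q \<in> {0..<?L} \<times> {0..<?L}"
  then obtain x y where q: "q = (x, y)" "0 \<le> x" "x < ?L" "0 \<le> y" "y < ?L"
    by auto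
  \<comment> \<open>For \<open>d k = 0\<close> the square would be empty and could not contain
    \<open>q\<close>.\<close>
  then have dpos: "d k > 0"
    using d by (cases "d k = 0") auto
  \<comment> \<open>These index the lower left corner of the cell containing \<open>q\<close>; the
    remainders modulo \<open>d k\<close> are the distances to it in each coordinate.\<close>
  define i j where "i = nat (x div d k)" and "j = nat (y div d k)"
  have ij: "int i = x div d k" "int j = y div d k"
    using q dpos by (auto simp: i_def j_def pos_imp_zdiv_nonneg_iff)
  have "z div d k < 2 ^ k" if "z < ?L" for z
  proof -
    have "z div d k * d k < 2 ^ k * d k"
      using that div_mult_mod_eq[of z "d k"] pos_mod_sign[OF dpos, of z] by linarith
    then show ?thesis
      using dpos by simp
  qed
  then have "x div d k < 2 ^ k" "y div d k < 2 ^ k"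
    using q by auto
  then have lt: "i < 2 ^ k" "j < 2 ^ k"
    using ij by (metis of_nat_less_numeral_power_cancel_iff of_nat_less_iff of_nat_numeral of_nat_power)+
  let ?p = "(int i * d k, int j * d k)"
  let ?m = "4 ^ k + (i * 2 ^ k + j)"
  have xy: "x = int i * d k + x mod d k" "y = int j * d k + y mod d k"
    by (simp_all add: ij)
  have md: "0 \<le> x mod d k" "x mod d k < d k" "0 \<le> y mod d k" "y mod d k < d k"
    using dpos by auto
  have "(i + 1) * 2 ^ k \<le> 2 ^ k * (2 ^ k :: nat)"
    using lt by (intro mult_right_mono) auto
  \<comment> \<open>The corner is activated before \<open>2 * 4 ^ k\<close>, so waiting another
    \<open>4 ^ k\<close> steps ends before \<open>3 * 4 ^ k\<close>, which is below
    \<open>4 ^ (k + 1)\<close>.\<close>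
  then have m: "?m + 4 ^ k \<le> n"
    using lt(2) n by (simp add: four_power_eq)
  have "?p \<in> {0..?L} \<times> {0..?L}"
    using lt dpos by (simp add: less_imp_le)
  moreover have "q \<in> {0..?L} \<times> {0..?L}"
    using q by auto
  moreover have "l1_dist ?p q \<le> 4 ^ k"
  proof -
    have "l1_dist ?p q = x mod d k + y mod d k"
      using xy md unfolding q(1) l1_dist_def fst_conv snd_conv by linarith
    then show ?thesis
      using md d by linarith
  qed
  moreover have "?p \<in> ?B ?m"
    using lattice_activation_eq[OF lt] by (rule activated_in_burning_set)
  moreover have "- r m' \<le> 0 \<and> ?L \<le> r m'" if "m' \<ge> ?m" for m'
  proof -
    have "?L \<le> r m'" "0 \<le> ?L"
      using r[of m'] that d(1) by simp_all
    then show ?thesis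
      by linarith
  qed
  ultimately have "q \<in> ?B (?m + 4 ^ k)"
    by (intro burning_set_spreads[where m = ?m and a = 0 and b = ?L and p = ?p]) simp_all
  then show "q \<in> ?B n"
    by (rule subsetD[OF burning_set_mono[OF m]])
qed

lemma activation_sequence_lattice:
  fixes r d :: "nat \<Rightarrow> int"
  assumes r: "\<And>k m. 4 ^ k \<le> m \<Longrightarrow> 2 ^ k * d k \<le> r m" and d: "\<And>k. 0 \<le> d k"
  shows "activation_sequence (\<lambda>n. grid_graph (- r n) (r n)) (lattice_activation d)"
proof -
  have "p \<in> pverts (grid_graph (- r m) (r m))" if *: "lattice_activation d m = Some p" for m p
  proof -
    obtain k i j where kij: "4 ^ k \<le> m" "i < 2 ^ k" "j < 2 ^ k" "p = (int i * d k, int j * d k)"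
      by (rule lattice_activation_SomeE[OF *])
    have "0 \<le> int i * d k" "0 \<le> int j * d k"
      using d[of k] by simp_all
    moreover have "int i * d k \<le> r m" "int j * d k \<le> r m"
      using lattice_point_le[OF kij(2) d[of k]] lattice_point_le[OF kij(3) d[of k]]
        r[OF kij(1)] d[of k] by linarith+
    ultimately show ?thesis
      using kij(4) by (auto simp: grid_graph_def)
  qed
  then show ?thesis
    unfolding activation_sequence_def
    by (metis imageI insertCI option.exhaust)
qed

section \<open>Growth of the squares and the density estimate\<close>

text \<open>This is why windows start at powers of 4: the side length at that time scales as
  \<open>2 ^ k * 4 ^ k\<close>, lattice points per side times spacing.\<close>

lemma four_power_powr: "real (4 ^ k) powr (3/2) = 8 ^ k"
proof -
  have "real (4 ^ k) powr (3/2) = (2 powr (2 * real k)) powr (3/2)"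
    by (simp add: powr_realpow powr_mult flip: powr_powr powr_realpow)
  also have "\<dots> = (2 powr 3) powr real k"
    by (simp only: powr_powr) simp
  finally show ?thesis
    by (simp add: powr_realpow)
qed

lemma eight_power_le_powr: "4 ^ k \<le> m \<Longrightarrow> 8 ^ k \<le> real m powr (3/2)"
  and powr_le_eight_power: "m \<le> 4 ^ k \<Longrightarrow> real m powr (3/2) \<le> 8 ^ k"
  unfolding four_power_powr[symmetric]
  by (rule powr_mono2; simp only: of_nat_le_iff of_nat_0_le_iff; simp)+

theorem theorem2:
  fixes c :: real
    and S :: "nat \<Rightarrow> (int \<times> int) pair_pre_digraph"
  assumes "c > 0"
    and "\<And>n. S n = grid_graph (- \<lceil>c * real n powr (3/2)\<rceil>) \<lceil>c * real n powr (3/2)\<rceil>"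
  shows "\<exists>v. activation_sequence S v \<and> lower_burning_density S v > 0"
proof -
  define r where "r n = \<lceil>c * real n powr (3/2)\<rceil>" for n
  \<comment> \<open>The bound \<open>c\<close> makes the lattice fit into the graph at time
    \<open>4 ^ k\<close>; the bound 1/2 gives \<open>2 * d k \<le> 4 ^ k\<close>.\<close>
  define c0 where "c0 = min c (1/2)"
  define d where "d k = \<lfloor>c0 * 4 ^ k\<rfloor>" for k
  define v where "v = lattice_activation d"
  \<comment> \<open>Quotient of the burnt area bound by the vertex count bound, with the common
    factor \<open>8 ^ k\<close> cancelled in both squares.\<close>
  define e where "e = (c0 / 2)\<^sup>2 / (128 * c + 3)\<^sup>2"
  have S: "S = (\<lambda>n. grid_graph (- r n) (r n))"
    using assms(2) by (auto simp: r_def)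
  have c0: "0 < c0" "c0 \<le> c" "c0 \<le> 1/2"
    using assms(1) by (auto simp: c0_def)
  have d: "0 \<le> d k" for k
    using c0 by (simp add: d_def)
  have d_le: "real_of_int (d k) \<le> c0 * 4 ^ k" for k
    by (simp add: d_def)
  have d2: "2 * d k \<le> 4 ^ k" for k
  proof -
    have "c0 * 4 ^ k \<le> 1/2 * 4 ^ k"
      using c0(3) by (intro mult_right_mono) auto
    then have "2 * real_of_int (d k) \<le> 4 ^ k"
      using d_le[of k] by linarith
    then have "real_of_int (2 * d k) \<le> real_of_int (4 ^ k)"
      by simp
    then show ?thesis
      by (simp only: of_int_le_iff)
  qed
  have rd: "2 ^ k * d k \<le> r m" if "4 ^ k \<le> m" for k m
  proof -
    have "real_of_int (2 ^ k * d k) \<le> 2 ^ k * (c0 * 4 ^ k)"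
      using d_le by simp
    also have "\<dots> = c0 * 8 ^ k"
      by (simp flip: power_mult_distrib)
    also have "\<dots> \<le> c * real m powr (3/2)"
      using c0 eight_power_le_powr[OF that] by (intro mult_mono) auto
    finally show ?thesis
      unfolding r_def by linarith
  qed
  have act: "activation_sequence S v"
    unfolding S v_def by (rule activation_sequence_lattice[OF rd d])
  have "ereal e \<le> lower_burning_density S v"
  proof -
    \<comment> \<open>From this level on, the rounding loss in \<open>d k\<close>, at most 1, is
      less than half of \<open>c0 * 4 ^ k\<close>.\<close>
    obtain K where "2 / c0 < 4 ^ K"
      using real_arch_pow[of 4 "2 / c0"] by auto
    then have K: "2 < c0 * 4 ^ K"
      using c0 by (simp add: field_simps)
    have "e \<le> real (card (burning_set S v n)) / real (card (pverts (S n)))"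
      if n: "4 ^ (K + 1) \<le> n" for n
    proof -
      have "1 \<le> n"
        using n by (meson one_le_numeral one_le_power order_trans)
      then obtain l where l: "4 ^ l \<le> n" "n < 4 ^ (l + 1)"
        using ex_power_ivl1[of 4 n] by auto
      have "(4::nat) ^ (K + 1) < 4 ^ (l + 1)"
        using n l(2) by (rule le_less_trans)
      then have "K + 1 < l + 1"
        by (rule power_less_imp_less_exp[rotated]) simp
      \<comment> \<open>One level is given up: the square of window \<open>k\<close> is known to
        burn only from time \<open>4 ^ (k + 1) = 4 ^ l\<close> on.\<close>
      then obtain k where k: "l = k + 1" "K \<le> k"
        by (cases l) auto
      let ?Q = "{0..<2 ^ k * d k} \<times> {0..<2 ^ k * d k}"
      have "2 < c0 * 4 ^ k"
        using K c0(1) k(2) by (smt (verit) mult_left_mono power_increasing)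
      then have "c0 / 2 * 4 ^ k \<le> real_of_int (d k)"
        unfolding d_def by linarith
      then have "2 ^ k * (c0 / 2 * 4 ^ k) \<le> 2 ^ k * real_of_int (d k)"
        by simp
      also have "2 ^ k * (c0 / 2 * 4 ^ k) = c0 / 2 * 8 ^ k"
        by (simp flip: power_mult_distrib)
      finally have "(c0 / 2 * 8 ^ k)\<^sup>2 \<le> (2 ^ k * real_of_int (d k))\<^sup>2"
        using c0 by (intro power_mono) auto
      also have "\<dots> = real (card ?Q)"
        using d[of k] by (simp add: card_cartesian_product power2_eq_square)
      also have "\<dots> \<le> real (card (burning_set S v n))"
      proof -
        have "finite (burning_set S v n)"
          using finite_subset[OF burning_set_subset_pverts[OF growing_graphs_squares[OF assms(1)]]]
            act unfolding S r_def by (auto simp: grid_graph_def)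
        moreover have "?Q \<subseteq> burning_set S v n"
          unfolding S v_def using rd d d2 l(1) k(1) by (intro square_burns) auto
        ultimately show ?thesis
          by (simp only: of_nat_le_iff card_mono)
      qed
      finally have num: "(c0 / 2 * 8 ^ k)\<^sup>2 \<le> real (card (burning_set S v n))" .
      \<comment> \<open>Since \<open>n < 4 ^ (k + 2)\<close>, the bound is
        \<open>8 ^ (k + 2)\<close>. Doubling gives the 128 in \<open>e\<close>; the 3 is 1 for the
        central vertex of a side plus 2 for the ceiling.\<close>
      have "real n powr (3/2) \<le> 64 * 8 ^ k"
        using powr_le_eight_power[of n "k + 2"] l(2) k(1) by simp
      then have "c * real n powr (3/2) \<le> c * (64 * 8 ^ k)"
        using assms(1) by simp
      then have "2 * real_of_int (r n) + 1 \<le> 128 * c * 8 ^ k + 3"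
        unfolding r_def by linarith
      also have "\<dots> \<le> (128 * c + 3) * 8 ^ k"
        by (simp add: algebra_simps)
      finally have r_le: "2 * real_of_int (r n) + 1 \<le> (128 * c + 3) * 8 ^ k" .
      have "0 \<le> c * real n powr (3/2)"
        using assms(1) by simp
      then have r0: "0 \<le> r n"
        unfolding r_def by linarith
      have card: "real (card (pverts (S n))) = (2 * real_of_int (r n) + 1)\<^sup>2"
        using r0 by (simp add: S grid_graph_def card_cartesian_product power2_eq_square)
      have den: "real (card (pverts (S n))) \<le> ((128 * c + 3) * 8 ^ k)\<^sup>2"
        unfolding card using r_le r0 by (intro power_mono) auto
      have "e = (c0 / 2 * 8 ^ k)\<^sup>2 / ((128 * c + 3) * 8 ^ k)\<^sup>2"
        unfolding e_def power_mult_distrib by simp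
      also have "\<dots> \<le> real (card (burning_set S v n)) / real (card (pverts (S n)))"
        using num den r0 by (intro frac_le) (auto simp: card)
      finally show ?thesis .
    qed
    then show ?thesis
      unfolding lower_burning_density_def
      by (intro Liminf_bounded eventually_sequentiallyI[of "4 ^ (K + 1)"]) simp
  qed
  moreover have "0 < e"
    using c0 assms(1) by (simp add: e_def)
  ultimately show ?thesis
    using act by (metis ereal_less(2) less_le_trans)
qed

end
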